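(* A nontrivial Puiseux monoid is a C-monoid if and only if it is isomorphic to a numerical monoid.
   Context: A monoid is a commutative cancellative semigroup with identity; $M^\times$ denotes its group of units. A Puiseux monoid is an additive submonoid of $\mathbb{Q}_{\ge 0}$; it is nontrivial if it is not $\{0\}$. A numerical monoid is a submonoid of $(\mathbb{N}_0,+)$ with finite complement in $\mathbb{N}_0$. A monoid is factorial if every non-unit element is a product of primes (a sum of primes in additive notation). Let $D$ be a monoid (written multiplicatively) with quotient group $\mathsf{g}(D)$, and let $M$ be a submonoid of $D$. Elements $x, y \in D$ are $M$-equivalent if $x^{-1}M \cap D = y^{-1}M \cap D$ (as subsets of $\mathsf{g}(D)$); this is a congruence on $D$, and $[x]^D_M$ denotes the class of $x$. The reduced class semigroup of $M$ in $D$ is $\mathcal{C}^*(M,D) = \{[x]^D_M \mid x \in (D \setminus D^\times) \cup \{1\}\}$. A monoid $M$ is a C-monoid if it is a submonoid of a factorial monoid $F$ such that $F^\times \cap M = M^\times$ and $\mathcal{C}^*(M,F)$ is finite. *)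

theory Defs
  imports "HOL-Algebra.Divisibility" "HOL-Algebra.Coset" "HOL-Library.Infinite_Typeclass"
begin

section \<open>Puiseux monoids and numerical monoids\<close>

definition additive_monoid :: "'a::comm_monoid_add set \<Rightarrow> 'a monoid"
  where "additive_monoid A = \<lparr>carrier = A, mult = (+), one = 0\<rparr>"

definition puiseux_monoid :: "rat set \<Rightarrow> bool"
  where "puiseux_monoid M \<longleftrightarrow> submonoid M (additive_monoid {0..})"

definition numerical_monoid :: "nat set \<Rightarrow> bool"
  where "numerical_monoid N \<longleftrightarrow> submonoid N (additive_monoid UNIV) \<and> finite (- N)"


section \<open>The quotient group of a commutative cancellative monoid\<close>

text \<open>Fractions \<open>a/b\<close> are classes of pairs \<open>(a, b)\<close>, with \<open>a/b = c/d\<close> iff \<open>ad = cb\<close>.\<close>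

definition frac_rel :: "('a, 'b) monoid_scheme \<Rightarrow> (('a \<times> 'a) \<times> ('a \<times> 'a)) set"
  where "frac_rel D = {((a, b), (c, d)) | a b c d.
    a \<in> carrier D \<and> b \<in> carrier D \<and> c \<in> carrier D \<and> d \<in> carrier D \<and>
    a \<otimes>\<^bsub>D\<^esub> d = c \<otimes>\<^bsub>D\<^esub> b}"

definition mk_frac :: "('a, 'b) monoid_scheme \<Rightarrow> 'a \<Rightarrow> 'a \<Rightarrow> ('a \<times> 'a) set"
  where "mk_frac D a b = frac_rel D `` {(a, b)}"

definition quotient_group :: "('a, 'b) monoid_scheme \<Rightarrow> ('a \<times> 'a) set monoid"
  where "quotient_group D =
    \<lparr>carrier = (carrier D \<times> carrier D) // frac_rel D,
     mult = (\<lambda>X Y. \<Union>(a, b)\<in>X. \<Union>(c, d)\<in>Y. mk_frac D (a \<otimes>\<^bsub>D\<^esub> c) (b \<otimes>\<^bsub>D\<^esub> d)),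
     one = mk_frac D \<one>\<^bsub>D\<^esub> \<one>\<^bsub>D\<^esub>\<rparr>"

definition to_quotient :: "('a, 'b) monoid_scheme \<Rightarrow> 'a \<Rightarrow> ('a \<times> 'a) set"
  where "to_quotient D x = mk_frac D x \<one>\<^bsub>D\<^esub>"


section \<open>Class semigroups and C-monoids\<close>

text \<open>The set \<open>x\<^sup>-\<^sup>1M \<inter> D\<close>, where \<open>M\<close> and \<open>D\<close> are identified with their images
  in the quotient group of \<open>D\<close>.\<close>

definition colon_set :: "('a, 'b) monoid_scheme \<Rightarrow> 'a set \<Rightarrow> 'a \<Rightarrow> ('a \<times> 'a) set set"
  where "colon_set D M x =
    (inv\<^bsub>quotient_group D\<^esub> (to_quotient D x) <#\<^bsub>quotient_group D\<^esub> (to_quotient D ` M))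
      \<inter> to_quotient D ` carrier D"

definition M_equivalence :: "('a, 'b) monoid_scheme \<Rightarrow> 'a set \<Rightarrow> ('a \<times> 'a) set"
  where "M_equivalence D M =
    {(x, y). x \<in> carrier D \<and> y \<in> carrier D \<and> colon_set D M x = colon_set D M y}"

definition reduced_class_semigroup :: "'a set \<Rightarrow> ('a, 'b) monoid_scheme \<Rightarrow> 'a set set"
  where "reduced_class_semigroup M D =
    {M_equivalence D M `` {x} | x. x \<in> (carrier D - Units D) \<union> {\<one>\<^bsub>D\<^esub>}}"

text \<open>\<open>H\<close> is a submonoid of the factorial monoid \<open>F\<close> witnessing that \<open>H\<close> is a C-monoid.\<close>

definition C_submonoid :: "'a set \<Rightarrow> ('a, 'b) monoid_scheme \<Rightarrow> bool"
  where "C_submonoid H F \<longleftrightarrow>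
    factorial_monoid F \<and> submonoid H F \<and>
    Units F \<inter> H = Units (F\<lparr>carrier := H\<rparr>) \<and>
    finite (reduced_class_semigroup H F)"

text \<open>
  HOL cannot quantify over types inside a formula, so the type \<open>'f\<close> holding the factorial
  monoid is a parameter, and being a submonoid means being isomorphic to a submonoid of a
  monoid on \<open>'f\<close>. For countable \<open>M\<close> every infinite \<open>'f\<close> yields the same notion: a factorial
  overmonoid of \<open>M\<close> in any type can be cut down to a countable submonoid that contains \<open>M\<close>
  and is closed under inverses of units and under a choice of prime factorizations; this
  submonoid is again factorial, and none of the conditions is lost.
\<close>

definition C_monoid :: "'f itself \<Rightarrow> ('a, 'b) monoid_scheme \<Rightarrow> bool"
  where "C_monoid (_ :: 'f itself) M \<longleftrightarrow>
    (\<exists>(F :: 'f monoid) H. C_submonoid H F \<and> M \<cong> F\<lparr>carrier := H\<rparr>)"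


section \<open>Agreement with the elementary descriptions\<close>

text \<open>The library defines factorial monoids by unique factorization into irreducibles; this is
  equivalent to every non-unit being a product of primes.\<close>

lemma factorial_monoid_iff_prime_products:
  "factorial_monoid G \<longleftrightarrow> comm_monoid_cancel G \<and>
    (\<forall>a\<in>carrier G. a \<notin> Units G \<longrightarrow>
      (\<exists>ps. set ps \<subseteq> carrier G \<and> (\<forall>p\<in>set ps. prime G p) \<and>
            foldr (\<otimes>\<^bsub>G\<^esub>) ps \<one>\<^bsub>G\<^esub> = a))"
  (is "_ \<longleftrightarrow> _ \<and> ?P")
proof
  assume "factorial_monoid G"
  then interpret factorial_monoid G .
  have ?P
  proof (intro ballI impI)
    fix a assume "a \<in> carrier G" "a \<notin> Units G"
    then obtain fs where fs: "set fs \<subseteq> carrier G" "factors G fs a"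
      using factors_exist by blast
    then have "\<forall>p\<in>set fs. prime G p"
      using irreducible_prime unfolding factors_def by blast
    with fs show "\<exists>ps. set ps \<subseteq> carrier G \<and> (\<forall>p\<in>set ps. prime G p) \<and>
        foldr (\<otimes>\<^bsub>G\<^esub>) ps \<one>\<^bsub>G\<^esub> = a"
      unfolding factors_def by blast
  qed
  then show "comm_monoid_cancel G \<and> ?P"
    using comm_monoid_cancel_axioms by blast
next
  assume asm: "comm_monoid_cancel G \<and> ?P"
  then interpret comm_monoid_cancel G by blast
  interpret primeness_condition_monoid G
  proof
    fix a assume a: "a \<in> carrier G" "irreducible G a"
    then have nu: "a \<notin> Units G" by (auto simp: irreducible_def)
    with a asm obtain ps where ps: "set ps \<subseteq> carrier G" "\<forall>p\<in>set ps. prime G p"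
        "foldr (\<otimes>\<^bsub>G\<^esub>) ps \<one>\<^bsub>G\<^esub> = a"
      by blast
    show "prime G a"
    proof (cases ps)
      case Nil
      then have "a = \<one>\<^bsub>G\<^esub>" using ps by simp
      with nu show ?thesis by simp
    next
      case (Cons p qs)
      have p: "p \<in> carrier G" "prime G p" using ps Cons by auto
      have "foldr (\<otimes>\<^bsub>G\<^esub>) qs \<one>\<^bsub>G\<^esub> \<in> carrier G"
        using ps Cons by (intro multlist_closed) auto
      then have pa: "p divides\<^bsub>G\<^esub> a" using ps Cons by (auto simp: factor_def)
      have "\<not> properfactor G p a"
        using a p by (auto simp: irreducible_def prime_def)
      then have "p \<sim>\<^bsub>G\<^esub> a" using pa by (auto simp: properfactor_def associated_def)
      then show ?thesis using p a prime_cong by blast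
    qed
  qed
  show "factorial_monoid G"
  proof (rule factorial_monoidI)
    fix a assume a: "a \<in> carrier G" "a \<notin> Units G"
    then obtain ps where ps: "set ps \<subseteq> carrier G" "\<forall>p\<in>set ps. prime G p"
        "foldr (\<otimes>\<^bsub>G\<^esub>) ps \<one>\<^bsub>G\<^esub> = a"
      using asm by blast
    then have "wfactors G ps a"
      using a prime_irreducible unfolding wfactors_def by auto
    with ps show "\<exists>fs. set fs \<subseteq> carrier G \<and> wfactors G fs a" by blast
  qed (rule wfactors_unique)
qed

context comm_monoid_cancel
begin

lemma frac_rel_iff:
  "((a, b), (c, d)) \<in> frac_rel G \<longleftrightarrow>
    a \<in> carrier G \<and> b \<in> carrier G \<and> c \<in> carrier G \<and> d \<in> carrier G \<and> a \<otimes> d = c \<otimes> b"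
  by (auto simp: frac_rel_def)

lemma equiv_frac_rel: "equiv (carrier G \<times> carrier G) (frac_rel G)"
proof (rule equivI)
  show "frac_rel G \<subseteq> (carrier G \<times> carrier G) \<times> (carrier G \<times> carrier G)"
    by (auto simp: frac_rel_def)
  show "refl_on (carrier G \<times> carrier G) (frac_rel G)"
    by (auto simp: refl_on_def frac_rel_def)
  show "sym (frac_rel G)"
    by (auto simp: sym_def frac_rel_def)
  show "trans (frac_rel G)"
  proof (rule transI)
    fix x y z assume xy: "(x, y) \<in> frac_rel G" and yz: "(y, z) \<in> frac_rel G"
    obtain a b c d e f where eqs: "x = (a, b)" "y = (c, d)" "z = (e, f)"
      by (meson surj_pair)
    with xy yz have cl: "a \<in> carrier G" "b \<in> carrier G" "c \<in> carrier G" "d \<in> carrier G"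
        "e \<in> carrier G" "f \<in> carrier G" and e1: "a \<otimes> d = c \<otimes> b" and e2: "c \<otimes> f = e \<otimes> d"
      by (auto simp: frac_rel_iff)
    have "d \<otimes> (a \<otimes> f) = (a \<otimes> d) \<otimes> f" using cl by (simp add: m_ac)
    also have "\<dots> = (c \<otimes> f) \<otimes> b" using cl e1 by (simp add: m_ac)
    also have "\<dots> = d \<otimes> (e \<otimes> b)" using cl e2 by (simp add: m_ac)
    finally have "a \<otimes> f = e \<otimes> b" using cl l_cancel by simp
    with cl eqs show "(x, z) \<in> frac_rel G" by (simp add: frac_rel_iff)
  qed
qed

lemma frac_eq_iff:
  assumes "a \<in> carrier G" "b \<in> carrier G" "c \<in> carrier G" "d \<in> carrier G"
  shows "mk_frac G a b = mk_frac G c d \<longleftrightarrow> a \<otimes> d = c \<otimes> b"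
  using assms eq_equiv_class_iff[OF equiv_frac_rel, of "(a, b)" "(c, d)"]
  by (simp add: mk_frac_def frac_rel_iff)

lemma mem_frac_iff:
  assumes "a \<in> carrier G" "b \<in> carrier G"
  shows "(c, d) \<in> mk_frac G a b \<longleftrightarrow> c \<in> carrier G \<and> d \<in> carrier G \<and> a \<otimes> d = c \<otimes> b"
  using assms by (auto simp: mk_frac_def frac_rel_iff)

lemma frac_in_carrier [simp]:
  "a \<in> carrier G \<Longrightarrow> b \<in> carrier G \<Longrightarrow> mk_frac G a b \<in> carrier (quotient_group G)"
  by (auto simp: quotient_group_def mk_frac_def intro!: quotientI)

lemma quotient_group_cases:
  assumes "X \<in> carrier (quotient_group G)"
  obtains a b where "a \<in> carrier G" "b \<in> carrier G" "X = mk_frac G a b"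
  using assms by (auto simp: quotient_group_def mk_frac_def elim!: quotientE)

lemma quotient_group_one: "\<one>\<^bsub>quotient_group G\<^esub> = mk_frac G \<one> \<one>"
  by (simp add: quotient_group_def)

lemma quotient_group_mult:
  assumes cl: "a \<in> carrier G" "b \<in> carrier G" "c \<in> carrier G" "d \<in> carrier G"
  shows "mk_frac G a b \<otimes>\<^bsub>quotient_group G\<^esub> mk_frac G c d = mk_frac G (a \<otimes> c) (b \<otimes> d)"
proof -
  have *: "mk_frac G (a' \<otimes> c') (b' \<otimes> d') = mk_frac G (a \<otimes> c) (b \<otimes> d)"
    if ab': "(a', b') \<in> mk_frac G a b" and cd': "(c', d') \<in> mk_frac G c d" for a' b' c' d'
  proof -
    have cl': "a' \<in> carrier G" "b' \<in> carrier G" "c' \<in> carrier G" "d' \<in> carrier G"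
      and e1: "a \<otimes> b' = a' \<otimes> b" and e2: "c \<otimes> d' = c' \<otimes> d"
      using ab' cd' cl by (auto simp: mem_frac_iff)
    have "(a' \<otimes> c') \<otimes> (b \<otimes> d) = (a' \<otimes> b) \<otimes> (c' \<otimes> d)" using cl cl' by (simp add: m_ac)
    also have "\<dots> = (a \<otimes> b') \<otimes> (c \<otimes> d')" using e1 e2 by simp
    also have "\<dots> = (a \<otimes> c) \<otimes> (b' \<otimes> d')" using cl cl' by (simp add: m_ac)
    finally show ?thesis using cl cl' by (simp add: frac_eq_iff)
  qed
  have ab: "(a, b) \<in> mk_frac G a b" and cd: "(c, d) \<in> mk_frac G c d"
    using cl by (auto simp: mem_frac_iff)
  have "mk_frac G a b \<otimes>\<^bsub>quotient_group G\<^esub> mk_frac G c d =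
      (\<Union>p\<in>mk_frac G a b. \<Union>q\<in>mk_frac G c d. mk_frac G (fst p \<otimes> fst q) (snd p \<otimes> snd q))"
    by (simp add: quotient_group_def case_prod_beta)
  also have "\<dots> = (\<Union>p\<in>mk_frac G a b. \<Union>q\<in>mk_frac G c d. mk_frac G (a \<otimes> c) (b \<otimes> d))"
    by (intro SUP_cong refl *) auto
  also have "\<dots> = mk_frac G (a \<otimes> c) (b \<otimes> d)"
    using ab cd by blast
  finally show ?thesis .
qed

lemma comm_group_quotient_group: "comm_group (quotient_group G)"
proof (rule comm_groupI)
  fix X Y assume "X \<in> carrier (quotient_group G)" "Y \<in> carrier (quotient_group G)"
  then show "X \<otimes>\<^bsub>quotient_group G\<^esub> Y \<in> carrier (quotient_group G)"
    by (auto elim!: quotient_group_cases simp: quotient_group_mult)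
next
  show "\<one>\<^bsub>quotient_group G\<^esub> \<in> carrier (quotient_group G)"
    by (simp add: quotient_group_one)
next
  fix X Y Z assume "X \<in> carrier (quotient_group G)" "Y \<in> carrier (quotient_group G)"
    "Z \<in> carrier (quotient_group G)"
  then show "X \<otimes>\<^bsub>quotient_group G\<^esub> Y \<otimes>\<^bsub>quotient_group G\<^esub> Z
      = X \<otimes>\<^bsub>quotient_group G\<^esub> (Y \<otimes>\<^bsub>quotient_group G\<^esub> Z)"
    by (auto elim!: quotient_group_cases simp: quotient_group_mult m_assoc)
next
  fix X Y assume "X \<in> carrier (quotient_group G)" "Y \<in> carrier (quotient_group G)"
  then show "X \<otimes>\<^bsub>quotient_group G\<^esub> Y = Y \<otimes>\<^bsub>quotient_group G\<^esub> X"
    by (auto elim!: quotient_group_cases simp: quotient_group_mult m_comm)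
next
  fix X assume "X \<in> carrier (quotient_group G)"
  then show "\<one>\<^bsub>quotient_group G\<^esub> \<otimes>\<^bsub>quotient_group G\<^esub> X = X"
    by (auto elim!: quotient_group_cases simp: quotient_group_mult quotient_group_one)
next
  fix X assume "X \<in> carrier (quotient_group G)"
  then obtain a b where X: "a \<in> carrier G" "b \<in> carrier G" "X = mk_frac G a b"
    by (rule quotient_group_cases)
  then have "mk_frac G b a \<otimes>\<^bsub>quotient_group G\<^esub> X = \<one>\<^bsub>quotient_group G\<^esub>"
    by (simp add: quotient_group_mult quotient_group_one frac_eq_iff m_comm)
  with X show "\<exists>Y\<in>carrier (quotient_group G).
      Y \<otimes>\<^bsub>quotient_group G\<^esub> X = \<one>\<^bsub>quotient_group G\<^esub>"
    by (intro bexI[of _ "mk_frac G b a"]) auto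
qed

lemma to_quotient_hom: "to_quotient G \<in> hom G (quotient_group G)"
  by (auto simp: hom_def to_quotient_def quotient_group_mult)

lemma inj_on_to_quotient: "inj_on (to_quotient G) (carrier G)"
  by (auto simp: inj_on_def to_quotient_def frac_eq_iff)

lemma inv_to_quotient:
  assumes "x \<in> carrier G"
  shows "inv\<^bsub>quotient_group G\<^esub> (to_quotient G x) = mk_frac G \<one> x"
proof -
  interpret Q: comm_group "quotient_group G" by (rule comm_group_quotient_group)
  show ?thesis
    using assms
    by (intro Q.inv_equality)
       (auto simp: to_quotient_def quotient_group_mult quotient_group_one frac_eq_iff)
qed

lemma colon_set_eq:
  assumes "M \<subseteq> carrier G" "x \<in> carrier G"
  shows "colon_set G M x = to_quotient G ` {z \<in> carrier G. x \<otimes> z \<in> M}"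
proof -
  have *: "mk_frac G \<one> x \<otimes>\<^bsub>quotient_group G\<^esub> to_quotient G m = to_quotient G z \<longleftrightarrow> m = x \<otimes> z"
    if "m \<in> carrier G" "z \<in> carrier G" for m z
    using that assms by (auto simp: to_quotient_def quotient_group_mult frac_eq_iff m_comm)
  have "colon_set G M x = {w. (\<exists>m\<in>M. \<exists>z\<in>carrier G. w = to_quotient G z \<and>
      mk_frac G \<one> x \<otimes>\<^bsub>quotient_group G\<^esub> to_quotient G m = to_quotient G z)}"
    unfolding colon_set_def l_coset_def inv_to_quotient[OF assms(2)] by auto
  also have "\<dots> = {w. \<exists>m\<in>M. \<exists>z\<in>carrier G. w = to_quotient G z \<and> m = x \<otimes> z}"
    using * assms(1) by (metis (no_types, lifting) subsetD)
  also have "\<dots> = to_quotient G ` {z \<in> carrier G. x \<otimes> z \<in> M}"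
    by auto
  finally show ?thesis .
qed

lemma M_equivalence_iff:
  assumes "M \<subseteq> carrier G"
  shows "(x, y) \<in> M_equivalence G M \<longleftrightarrow> x \<in> carrier G \<and> y \<in> carrier G \<and>
    (\<forall>z\<in>carrier G. x \<otimes> z \<in> M \<longleftrightarrow> y \<otimes> z \<in> M)"
proof -
  have "colon_set G M x = colon_set G M y \<longleftrightarrow>
      {z \<in> carrier G. x \<otimes> z \<in> M} = {z \<in> carrier G. y \<otimes> z \<in> M}"
    if "x \<in> carrier G" "y \<in> carrier G"
    using that assms by (simp add: colon_set_eq inj_on_image_eq_iff[OF inj_on_to_quotient])
  then show ?thesis unfolding M_equivalence_def by blast
qed

end

end

theory Submission
  imports Defs
begin

text \<open>
  Let \<open>M\<close> be a nontrivial Puiseux monoid, embedded by \<open>\<phi>\<close> as a submonoid \<open>H\<close> of a factorial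
  monoid \<open>F\<close> with \<open>F\<^sup>\<times> \<inter> H = H\<^sup>\<times>\<close>. The number of prime factors, counted with multiplicity, is a
  homomorphism \<open>L\<close> from \<open>F\<close> to the natural numbers, and \<open>L\<close> vanishes exactly on the units of \<open>F\<close>.
  As \<open>M\<close> is reduced and the units of \<open>F\<close> inside \<open>H\<close> are units of \<open>H\<close>, the additive function
  \<open>L \<circ> \<phi>\<close> on \<open>M\<close> vanishes only at \<open>0\<close>. An additive function on a monoid of nonnegative rationals
  is multiplication by a constant, because any two nonzero rationals have a common nonzero
  multiple (lemma \<open>additive_proportional\<close>). Hence \<open>L \<circ> \<phi>\<close> is injective, and \<open>M\<close> is
  isomorphic to a nontrivial additive monoid of natural numbers, which is in turn a multiple
  \<open>d N\<close> of a numerical monoid \<open>N\<close> (lemma \<open>nat_submonoid_eq_scaled_numerical\<close>).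

  Conversely, the natural numbers under addition are factorial, with \<open>1\<close> as the only prime, and
  they are reduced, so that the condition on units holds for each of their submonoids. If \<open>N\<close>
  contains all numbers from \<open>c\<close> on, then all \<open>x \<ge> c\<close> are \<open>N\<close>-equivalent, so there are at most
  \<open>c + 1\<close> classes. A copy of the natural numbers along an injection carries this over to any
  infinite type.
\<close>

section \<open>Additive functions on Puiseux monoids\<close>

lemma puiseux_monoidD:
  assumes "puiseux_monoid M"
  shows "0 \<in> M" "x \<in> M \<Longrightarrow> y \<in> M \<Longrightarrow> x + y \<in> M" "x \<in> M \<Longrightarrow> 0 \<le> x"
  using submonoid.subset[OF assms[unfolded puiseux_monoid_def]]
    submonoid.m_closed[OF assms[unfolded puiseux_monoid_def], of x y]
    submonoid.one_closed[OF assms[unfolded puiseux_monoid_def]]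
  by (auto simp: additive_monoid_def)

lemma puiseux_monoid_multiple:
  assumes "puiseux_monoid M" "x \<in> M"
  shows "of_nat n * x \<in> M"
  by (induction n) (auto simp: algebra_simps assms puiseux_monoidD[OF assms(1)])

lemma additive_multiple:
  fixes h :: "rat \<Rightarrow> nat"
  assumes M: "puiseux_monoid M"
    and add: "\<And>x y. x \<in> M \<Longrightarrow> y \<in> M \<Longrightarrow> h (x + y) = h x + h y"
    and x: "x \<in> M"
  shows "h (of_nat n * x) = n * h x"
proof (induction n)
  case 0
  show ?case using add[of 0 0] puiseux_monoidD(1)[OF M] by simp
next
  case (Suc n)
  have "h (of_nat n * x + x) = h (of_nat n * x) + h x"
    by (rule add) (use x puiseux_monoid_multiple[OF M x] in auto)
  with Suc show ?case by (simp add: algebra_simps)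
qed

text \<open>For \<open>x = a/b\<close> and \<open>y = c/d\<close> the number \<open>ac\<close> is both the \<open>cb\<close>-fold multiple of \<open>x\<close> and the
  \<open>ad\<close>-fold multiple of \<open>y\<close>; both expressions are evaluated under \<open>h\<close>.\<close>

lemma additive_proportional:
  fixes h :: "rat \<Rightarrow> nat"
  assumes M: "puiseux_monoid M"
    and add: "\<And>x y. x \<in> M \<Longrightarrow> y \<in> M \<Longrightarrow> h (x + y) = h x + h y"
    and x: "x \<in> M" and y: "y \<in> M"
  shows "of_nat (h x) * y = of_nat (h y) * x"
proof -
  have frac: "\<exists>a b. b > 0 \<and> z = of_nat a / of_nat b" if "z \<in> M" for z
  proof -
    obtain a b where ab: "b > 0" "z = Fract a b" by (cases z)
    have "a \<ge> 0" using puiseux_monoidD(3)[OF M that] ab by (simp add: zero_le_Fract_iff)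
    then show ?thesis using ab
      by (intro exI[of _ "nat a"] exI[of _ "nat b"]) (simp add: Fract_of_int_quotient)
  qed
  obtain a b where ab: "b > 0" "x = of_nat a / of_nat b" using frac[OF x] by blast
  obtain c d where cd: "d > 0" "y = of_nat c / of_nat d" using frac[OF y] by blast
  have "of_nat (c * b) * x = of_nat (a * d) * y"
    using ab cd by simp
  then have "(c * b) * h x = (a * d) * h y"
    using additive_multiple[OF M add x, of "c * b"] additive_multiple[OF M add y, of "a * d"]
    by simp
  then have "of_nat (c * b * h x) = (of_nat (a * d * h y) :: rat)" by simp
  moreover have "of_nat a = x * of_nat b" "of_nat c = y * of_nat d" using ab cd by simp_all
  ultimately have "of_nat (b * d) * (of_nat (h x) * y) = of_nat (b * d) * (of_nat (h y) * x)"
    by (simp add: ac_simps)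
  then show ?thesis using ab(1) cd(1) by simp
qed

section \<open>Monoids of natural numbers\<close>

text \<open>The scaling factor \<open>d\<close> is the least positive difference of two elements of \<open>S\<close>. If \<open>s - t = d\<close>
  and \<open>x \<in> S\<close> leaves the remainder \<open>r\<close> when divided by \<open>d\<close>, with quotient \<open>k\<close>, then \<open>r\<close> is the
  difference of \<open>x + k t\<close> and \<open>k s\<close>, so \<open>r = 0\<close> by minimality. After division by \<open>d\<close> there are two
  consecutive elements \<open>u\<close> and \<open>u + 1\<close>. If \<open>u > 0\<close>, a number \<open>n \<ge> u\<^sup>2\<close> is \<open>q u + r\<close> with
  \<open>r < u \<le> q\<close>, which equals \<open>(q - r) u + r (u + 1)\<close>; if \<open>u = 0\<close>, the element \<open>1\<close> generates
  all numbers.\<close>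

lemma nat_submonoid_eq_scaled_numerical:
  fixes S :: "nat set"
  assumes zero: "0 \<in> S" and add: "\<And>x y. x \<in> S \<Longrightarrow> y \<in> S \<Longrightarrow> x + y \<in> S"
    and nontrivial: "S \<noteq> {0}"
  obtains d N where "d > 0" "numerical_monoid N" "S = (*) d ` N"
proof -
  have mult: "k * x \<in> S" if "x \<in> S" for k x
    by (induction k) (use zero add that in auto)
  define P where "P d \<longleftrightarrow> d > 0 \<and> (\<exists>s t. s \<in> S \<and> t \<in> S \<and> s = t + d)" for d
  define d where "d = (LEAST d. P d)"
  obtain s0 where "s0 \<in> S" "s0 > 0" using zero nontrivial
    by (metis empty_iff gr0I subsetI subset_singletonD singletonI)
  then have "P s0" unfolding P_def using zero by (intro conjI exI[of _ s0] exI[of _ 0]) auto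
  then have "P d" unfolding d_def by (rule LeastI)
  then obtain s t where d0: "d > 0" and st: "s \<in> S" "t \<in> S" "s = t + d"
    by (auto simp: P_def)
  have least: "d \<le> r" if "P r" for r unfolding d_def using that by (rule Least_le)
  have dvd: "d dvd x" if x: "x \<in> S" for x
  proof (rule ccontr)
    assume "\<not> d dvd x"
    then have pos: "x mod d > 0" by (auto simp: dvd_eq_mod_eq_0)
    let ?k = "x div d"
    have "x + ?k * t = ?k * s + x mod d"
      using st(3) div_mult_mod_eq[of x d] by (simp add: algebra_simps)
    moreover have "x + ?k * t \<in> S" "?k * s \<in> S" using x st add mult by auto
    ultimately have "P (x mod d)" unfolding P_def using pos by blast
    then show False using least[of "x mod d"] mod_less_divisor[OF d0, of x] by linarith
  qed
  define N where "N = {n. d * n \<in> S}"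
  have SN: "S = (*) d ` N" using dvd by (auto simp: N_def)
  have N0: "0 \<in> N" using zero by (simp add: N_def)
  have Nadd: "x + y \<in> N" if "x \<in> N" "y \<in> N" for x y
    using add that by (simp add: N_def algebra_simps)
  have Nmult: "k * x \<in> N" if "x \<in> N" for k x
    using mult[of "d * x" k] that by (simp add: N_def mult.left_commute)
  obtain u where u: "t = d * u" using dvd[OF st(2)] by auto
  have uN: "u \<in> N" "Suc u \<in> N" using st u by (auto simp: N_def add.commute)
  have "n \<in> N" if n: "n \<ge> u * u" for n
  proof (cases "u = 0")
    case True
    then show ?thesis using Nmult[OF uN(2), of n] by simp
  next
    case False
    let ?q = "n div u" and ?r = "n mod u"
    have "u \<le> ?q" using n False by (simp add: less_eq_div_iff_mult_less_eq)
    then have "?r \<le> ?q" using False by (meson le_trans less_imp_le mod_less_divisor not_gr_zero)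
    then obtain j where j: "?q = ?r + j" using le_Suc_ex by blast
    have "n = ?q * u + ?r" by simp
    also have "\<dots> = j * u + ?r * Suc u" by (subst j) (simp add: algebra_simps)
    finally show ?thesis using Nadd[OF Nmult[OF uN(1), of j] Nmult[OF uN(2), of ?r]] by simp
  qed
  then have "- N \<subseteq> {..<u * u}" by (auto simp: not_less[symmetric])
  then have "finite (- N)" using finite_subset by blast
  then have "numerical_monoid N"
    unfolding numerical_monoid_def additive_monoid_def
    by (auto intro!: submonoid.intro N0 Nadd)
  with d0 SN that show ?thesis by blast
qed

lemma numerical_monoidD:
  assumes "numerical_monoid N"
  shows "0 \<in> N" "x \<in> N \<Longrightarrow> y \<in> N \<Longrightarrow> x + y \<in> N" "\<exists>c. \<forall>n\<ge>c. n \<in> N"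
proof -
  have sub: "submonoid N (additive_monoid UNIV)" and fin: "finite (- N)"
    using assms by (auto simp: numerical_monoid_def)
  show "0 \<in> N" "x \<in> N \<Longrightarrow> y \<in> N \<Longrightarrow> x + y \<in> N"
    using submonoid.one_closed[OF sub] submonoid.m_closed[OF sub, of x y]
    by (auto simp: additive_monoid_def)
  obtain c where "\<forall>n\<in>- N. n < c" using fin finite_nat_set_iff_bounded by blast
  then show "\<exists>c. \<forall>n\<ge>c. n \<in> N" by (intro exI[of _ c]) (auto simp: not_less[symmetric])
qed

section \<open>C-monoids among Puiseux monoids are numerical\<close>

lemma (in factorial_monoid) factorcount_mult:
  assumes "a \<in> carrier G" "b \<in> carrier G"
  shows "factorcount G (a \<otimes> b) = factorcount G a + factorcount G b"
proof -
  obtain as bs where as: "set as \<subseteq> carrier G" "wfactors G as a"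
    and bs: "set bs \<subseteq> carrier G" "wfactors G bs b"
    using assms wfactors_exist by meson
  have "wfactors G (as @ bs) (a \<otimes> b)" using assms as bs by (intro wfactors_mult)
  then show ?thesis using assms as bs
    by (simp add: factorcount_unique[of as a] factorcount_unique[of bs b]
        factorcount_unique[of "as @ bs" "a \<otimes> b"])
qed

lemma (in factorial_monoid) Units_if_factorcount_eq_0:
  assumes a: "a \<in> carrier G" and 0: "factorcount G a = 0"
  shows "a \<in> Units G"
proof -
  obtain as where as: "set as \<subseteq> carrier G" "wfactors G as a"
    using a wfactors_exist by meson
  then have "as = []" using factorcount_unique[of as a] a 0 by simp
  with as have "\<one> \<sim> a" by (simp add: wfactors_def)
  then show ?thesis using a Units_cong Units_one_closed by blast
qed

text \<open>The isomorphism onto the numerical monoid sends an element of \<open>M\<close> to the number of prime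
  factors of its image in \<open>F\<close>, divided by a common scaling factor.\<close>

lemma puiseux_C_monoid_imp_numerical:
  fixes F :: "'f monoid"
  assumes M: "puiseux_monoid M" and nontrivial: "M \<noteq> {0}"
    and C: "C_submonoid H F" and iso: "additive_monoid M \<cong> F\<lparr>carrier := H\<rparr>"
  shows "\<exists>N. numerical_monoid N \<and> additive_monoid M \<cong> additive_monoid N"
proof -
  note M0 = puiseux_monoidD(1)[OF M] and M_add = puiseux_monoidD(2)[OF M]
    and M_nonneg = puiseux_monoidD(3)[OF M]
  interpret F: factorial_monoid F using C by (simp add: C_submonoid_def)
  interpret H: submonoid H F using C by (simp add: C_submonoid_def)
  have units: "Units F \<inter> H = Units (F\<lparr>carrier := H\<rparr>)" using C by (simp add: C_submonoid_def)
  obtain \<phi> where \<phi>: "\<phi> \<in> iso (additive_monoid M) (F\<lparr>carrier := H\<rparr>)"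
    using iso by (auto simp: is_iso_def)
  have \<phi>_add: "\<phi> (x + y) = \<phi> x \<otimes>\<^bsub>F\<^esub> \<phi> y" if "x \<in> M" "y \<in> M" for x y
    using \<phi> that by (auto simp: iso_iff hom_def additive_monoid_def)
  have \<phi>_image: "\<phi> ` M = H" and \<phi>_inj: "inj_on \<phi> M"
    using \<phi> by (auto simp: iso_iff additive_monoid_def)
  have \<phi>_F: "\<phi> x \<in> carrier F" if "x \<in> M" for x using that \<phi>_image H.subset by blast
  have \<phi>_0: "\<phi> 0 = \<one>\<^bsub>F\<^esub>"
    using \<phi>_add[OF M0 M0] \<phi>_F[OF M0] F.l_cancel[of "\<phi> 0" "\<phi> 0" "\<one>\<^bsub>F\<^esub>"] by simp
  define h where "h x = factorcount F (\<phi> x)" for x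
  have h_add: "h (x + y) = h x + h y" if "x \<in> M" "y \<in> M" for x y
    unfolding h_def using that by (simp add: \<phi>_add F.factorcount_mult \<phi>_F)
  \<comment> \<open>A unit of \<open>F\<close> in the image has its inverse in the image, and a nonnegative rational with
    a nonnegative additive inverse is \<open>0\<close>.\<close>
  have h_eq_0_imp: "x = 0" if x: "x \<in> M" and "h x = 0" for x
  proof -
    have "\<phi> x \<in> Units F" using that by (auto simp: h_def intro: F.Units_if_factorcount_eq_0 \<phi>_F)
    then have "\<phi> x \<in> Units (F\<lparr>carrier := H\<rparr>)" using units x \<phi>_image by blast
    then obtain y where y: "y \<in> H" "\<phi> x \<otimes>\<^bsub>F\<^esub> y = \<one>\<^bsub>F\<^esub>" by (auto simp: Units_def)
    then obtain z where z: "z \<in> M" "y = \<phi> z" using \<phi>_image by blast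
    have "\<phi> (x + z) = \<phi> 0" using y z x by (simp add: \<phi>_add \<phi>_0)
    then have "x + z = 0" using \<phi>_inj M0 M_add[OF x z(1)] by (auto dest: inj_onD)
    then show "x = 0" using M_nonneg[OF x] M_nonneg[OF z(1)] by simp
  qed
  obtain q where q: "q \<in> M" "q \<noteq> 0" using nontrivial M0 by blast
  have h_inj: "inj_on h M"
  proof (rule inj_onI)
    fix x y assume xy: "x \<in> M" "y \<in> M" "h x = h y"
    have "of_nat (h q) * x = of_nat (h q) * y"
      using additive_proportional[OF M h_add q(1) xy(1)] additive_proportional[OF M h_add q(1) xy(2)]
        xy(3) by simp
    then show "x = y" using h_eq_0_imp[OF q(1)] q(2) by auto
  qed
  have "0 \<in> h ` M" using h_add[OF M0 M0] M0 by force
  moreover have "a + b \<in> h ` M" if "a \<in> h ` M" "b \<in> h ` M" for a b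
    using that h_add M_add by (metis (no_types, lifting) imageE imageI)
  moreover have "h ` M \<noteq> {0}" using h_eq_0_imp q by blast
  ultimately obtain d N where d: "d > 0" and N: "numerical_monoid N" and im: "h ` M = (*) d ` N"
    by (rule nat_submonoid_eq_scaled_numerical)
  have h_dvd: "d dvd h x" if "x \<in> M" for x
    using im that by (metis dvd_triv_left imageE imageI)
  have "(\<lambda>x. h x div d) ` M = (\<lambda>n. n div d) ` (*) d ` N"
    unfolding im[symmetric] by (simp add: image_image)
  then have "(\<lambda>x. h x div d) ` M = N"
    using d by (simp add: image_image)
  moreover have "inj_on (\<lambda>x. h x div d) M"
    using h_inj h_dvd by (auto simp: inj_on_def dvd_div_eq_iff)
  moreover have "(\<lambda>x. h x div d) \<in> hom (additive_monoid M) (additive_monoid N)"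
    using h_dvd h_add calculation(1)
    by (auto simp: hom_def additive_monoid_def div_plus_div_distrib_dvd_left)
  ultimately have "(\<lambda>x. h x div d) \<in> iso (additive_monoid M) (additive_monoid N)"
    by (simp add: iso_iff additive_monoid_def)
  with N show ?thesis by (auto intro: is_isoI)
qed

section \<open>Numerical monoids are C-monoids\<close>

definition nat_copy :: "(nat \<Rightarrow> 'f) \<Rightarrow> 'f monoid"
  where "nat_copy f = \<lparr>carrier = range f, mult = (\<lambda>x y. f (the_inv f x + the_inv f y)), one = f 0\<rparr>"

context
  fixes f :: "nat \<Rightarrow> 'f"
  assumes f: "inj f"
begin

lemma nat_copy_simps [simp]:
  "carrier (nat_copy f) = range f" "\<one>\<^bsub>nat_copy f\<^esub> = f 0"
  "f m \<otimes>\<^bsub>nat_copy f\<^esub> f n = f (m + n)" "f m = f n \<longleftrightarrow> m = n"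
  using f by (auto simp: nat_copy_def inj_eq the_inv_f_f)

lemma comm_monoid_cancel_nat_copy: "comm_monoid_cancel (nat_copy f)"
  by (intro comm_monoid_cancelI comm_monoidI) (auto simp: add_ac)

lemma Units_nat_copy: "Units (nat_copy f) = {f 0}"
  by (auto simp: Units_def)

lemma divides_nat_copy: "f m divides\<^bsub>nat_copy f\<^esub> f n \<longleftrightarrow> m \<le> n"
  by (auto simp: factor_def le_iff_add)

lemma factorial_monoid_nat_copy: "factorial_monoid (nat_copy f)"
proof -
  have "prime (nat_copy f) (f 1)"
    by (auto simp: prime_def Units_nat_copy divides_nat_copy)
  moreover have "foldr (\<otimes>\<^bsub>nat_copy f\<^esub>) (replicate n (f 1)) \<one>\<^bsub>nat_copy f\<^esub> = f n" for n
    by (induction n) auto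
  ultimately have "\<exists>ps. set ps \<subseteq> carrier (nat_copy f) \<and> (\<forall>p\<in>set ps. prime (nat_copy f) p) \<and>
      foldr (\<otimes>\<^bsub>nat_copy f\<^esub>) ps \<one>\<^bsub>nat_copy f\<^esub> = f n" for n
    by (intro exI[of _ "replicate n (f 1)"]) (auto simp del: nat_copy_simps(2,3))
  then show ?thesis
    unfolding factorial_monoid_iff_prime_products
    using comm_monoid_cancel_nat_copy by auto
qed

lemma submonoid_nat_copy:
  assumes N: "numerical_monoid N"
  shows "submonoid (f ` N) (nat_copy f)"
  by (rule submonoid.intro) (auto simp: numerical_monoidD[OF N])

lemma finite_reduced_class_semigroup_nat_copy:
  assumes N: "numerical_monoid N"
  shows "finite (reduced_class_semigroup (f ` N) (nat_copy f))"
proof -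
  interpret comm_monoid_cancel "nat_copy f" by (rule comm_monoid_cancel_nat_copy)
  obtain c where c: "\<And>n. n \<ge> c \<Longrightarrow> n \<in> N" using numerical_monoidD(3)[OF N] by blast
  let ?E = "M_equivalence (nat_copy f) (f ` N)"
  have sub: "f ` N \<subseteq> carrier (nat_copy f)" by auto
  have large: "?E `` {f n} = ?E `` {f c}" if "n \<ge> c" for n
    using that c by (auto simp: M_equivalence_iff[OF sub] inj_image_mem_iff[OF f])
  have "?E `` {f n} \<in> (\<lambda>n. ?E `` {f n}) ` {..c}" for n
    using large[of n] by (cases "n \<le> c") auto
  then have "reduced_class_semigroup (f ` N) (nat_copy f) \<subseteq> (\<lambda>n. ?E `` {f n}) ` {..c}"
    by (auto simp: reduced_class_semigroup_def)
  then show ?thesis by (rule finite_subset) simp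
qed

lemma C_submonoid_nat_copy:
  assumes N: "numerical_monoid N"
  shows "C_submonoid (f ` N) (nat_copy f)"
proof -
  have "Units (nat_copy f) \<inter> f ` N = Units (nat_copy f\<lparr>carrier := f ` N\<rparr>)"
    using numerical_monoidD(1)[OF N] by (auto simp: Units_nat_copy) (auto simp: Units_def)
  then show ?thesis
    unfolding C_submonoid_def
    using factorial_monoid_nat_copy submonoid_nat_copy[OF N]
      finite_reduced_class_semigroup_nat_copy[OF N] by blast
qed

lemma iso_nat_copy: "f \<in> iso (additive_monoid N) (nat_copy f\<lparr>carrier := f ` N\<rparr>)"
  using f by (auto simp: iso_iff hom_def additive_monoid_def intro: inj_on_subset)

end

theorem proposition6p11:
  fixes M :: "rat set"
  assumes "puiseux_monoid M" and "M \<noteq> {0}"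
  shows "C_monoid TYPE('f::infinite) (additive_monoid M) \<longleftrightarrow>
    (\<exists>N. numerical_monoid N \<and> additive_monoid M \<cong> additive_monoid N)"
proof
  assume "C_monoid TYPE('f) (additive_monoid M)"
  then show "\<exists>N. numerical_monoid N \<and> additive_monoid M \<cong> additive_monoid N"
    unfolding C_monoid_def using puiseux_C_monoid_imp_numerical[OF assms] by blast
next
  assume "\<exists>N. numerical_monoid N \<and> additive_monoid M \<cong> additive_monoid N"
  then obtain N where N: "numerical_monoid N" and MN: "additive_monoid M \<cong> additive_monoid N"
    by blast
  obtain f :: "nat \<Rightarrow> 'f" where f: "inj f"
    using infinite_countable_subset[OF infinite_UNIV] by blast
  have "additive_monoid M \<cong> nat_copy f\<lparr>carrier := f ` N\<rparr>"
    using MN is_isoI[OF iso_nat_copy[OF f]] by (rule iso_trans)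
  then show "C_monoid TYPE('f) (additive_monoid M)"
    unfolding C_monoid_def using C_submonoid_nat_copy[OF f N] by blast
qed

end
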